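(* Let $a,b,n$ be positive integers with $ab\mid n$, and let $G$ be the one-paired circulant graph $G=C(n;a,b)$. (i) For each of the three properties "vertex decomposable", "shellable", "Cohen-Macaulay", the graph $G$ has that property if and only if $n=ab$. (ii) $G$ is Buchsbaum but not Cohen-Macaulay if and only if $a=1$ and $ab<n$. (iii) $\mathrm{Ind}(G)$ is pure but not Buchsbaum if and only if $1<a$ and $ab<n$.
   Context: For an integer $n\ge 1$ and a set $S\subseteq\{1,\ldots,\lfloor n/2\rfloor\}$, the circulant graph $C_n(S)$ has vertex set $\{0,1,\ldots,n-1\}$, and distinct $x,y$ are adjacent if and only if $|x-y|\in S$ or $n-|x-y|\in S$. For positive integers $a,b$ with $ab\mid n$, the one-paired circulant $C(n;a,b)$ is the circulant graph $C_n(S)$ with $S=\{d\in\{1,\ldots,\lfloor n/2\rfloor\} : a\mid d \text{ and } ab\nmid d\}$. The independence complex $\mathrm{Ind}(G)$ of a finite simple graph $G$ is the simplicial complex of all independent sets of $G$. A simplicial complex is pure if all its facets (maximal faces) have the same dimension. For a simplicial complex $\Delta$ and a face $F$: $\mathrm{link}_\Delta(F)=\{H\in\Delta : F\cap H=\emptyset,\ F\cup H\in\Delta\}$ and $\mathrm{del}_\Delta(F)=\{H\in\Delta : F\not\subseteq H\}$; for a vertex $x$ write $x$ instead of $\{x\}$. Also $\dim F=|F|-1$, and $\dim\Delta$ is the maximum dimension of a face of $\Delta$. Fix a field $k$. A pure simplicial complex $\Delta$ is: - vertex decomposable if $\Delta$ is a simplex (its whole vertex set is its unique facet), or there is a vertex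 $x$ such that $\mathrm{link}_\Delta(x)$ and $\mathrm{del}_\Delta(x)$ are (pure and) vertex decomposable; - shellable if its facets can be ordered $F_1,\ldots,F_t$ so that for all $1\le j<i\le t$ there are $x\in F_i\setminus F_j$ and $l\in\{1,\ldots,i-1\}$ with $F_i\setminus F_l=\{x\}$; - Cohen-Macaulay if for all $F\in\Delta$, $\tilde H_i(\mathrm{link}_\Delta(F),k)=0$ for all $i<\dim \mathrm{link}_\Delta(F)$ (reduced simplicial homology); - Buchsbaum if $\mathrm{link}_\Delta(x)$ is Cohen-Macaulay for every vertex $x$. A graph $G$ is said to have one of these properties if $\mathrm{Ind}(G)$ is pure and has it.
   Formalization: The case b = 1 with n > a is excluded (it is assumed that b ≥ 2 or n = ab), because there the graph has no edges and Ind(G) is a simplex, so (i) fails, e.g. for a = b = 1, n = 2. *)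

theory Defs
  imports "HOL-Library.Ramsey"
begin

section \<open>Simplicial complexes\<close>

text \<open>A simplicial complex is represented by its set of faces, which always contains the empty
  face. A vertex is an element \<open>x\<close> whose singleton is a face.\<close>

definition simplicial_complex :: "'a set set \<Rightarrow> bool" where
  "simplicial_complex \<Delta> \<longleftrightarrow>
     finite \<Delta> \<and> {} \<in> \<Delta> \<and> (\<forall>F\<in>\<Delta>. finite F \<and> (\<forall>H. H \<subseteq> F \<longrightarrow> H \<in> \<Delta>))"

definition vertices :: "'a set set \<Rightarrow> 'a set" where
  "vertices \<Delta> = {x. {x} \<in> \<Delta>}"

definition facets :: "'a set set \<Rightarrow> 'a set set" where
  "facets \<Delta> = {F \<in> \<Delta>. \<forall>H\<in>\<Delta>. F \<subseteq> H \<longrightarrow> H = F}"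

definition face_dim :: "'a set \<Rightarrow> int" where
  "face_dim F = int (card F) - 1"

definition complex_dim :: "'a set set \<Rightarrow> int" where
  "complex_dim \<Delta> = Max (face_dim ` \<Delta>)"

definition pure :: "'a set set \<Rightarrow> bool" where
  "pure \<Delta> \<longleftrightarrow> (\<forall>F\<in>facets \<Delta>. \<forall>H\<in>facets \<Delta>. face_dim F = face_dim H)"

definition link :: "'a set set \<Rightarrow> 'a set \<Rightarrow> 'a set set" where
  "link \<Delta> F = {H \<in> \<Delta>. F \<inter> H = {} \<and> F \<union> H \<in> \<Delta>}"

definition del :: "'a set set \<Rightarrow> 'a set \<Rightarrow> 'a set set" where
  "del \<Delta> F = {H \<in> \<Delta>. \<not> F \<subseteq> H}"

lemma simplicial_complex_link:
  assumes "simplicial_complex \<Delta>" "F \<in> \<Delta>"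
  shows "simplicial_complex (link \<Delta> F)"
proof -
  have down: "K \<in> \<Delta>" if "H \<in> \<Delta>" "K \<subseteq> H" for H K
    using assms(1) that unfolding simplicial_complex_def by blast
  have "K \<in> link \<Delta> F" if "H \<in> link \<Delta> F" "K \<subseteq> H" for H K
    using that down[of H K] down[of "F \<union> H" "F \<union> K"] unfolding link_def by blast
  moreover have "{} \<in> link \<Delta> F"
    using assms(2) down[of F "{}"] unfolding link_def by simp
  moreover have "link \<Delta> F \<subseteq> \<Delta>"
    unfolding link_def by blast
  ultimately show ?thesis
    using assms(1) finite_subset[of "link \<Delta> F" \<Delta>] unfolding simplicial_complex_def by blast
qed

lemma simplicial_complex_del:
  assumes "simplicial_complex \<Delta>" "F \<noteq> {}"
  shows "simplicial_complex (del \<Delta> F)"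
proof -
  have "del \<Delta> F \<subseteq> \<Delta>"
    unfolding del_def by blast
  then have "finite (del \<Delta> F)"
    using assms(1) finite_subset unfolding simplicial_complex_def by blast
  then show ?thesis
    using assms unfolding simplicial_complex_def del_def by blast
qed


section \<open>Reduced simplicial homology with coefficients in a field\<close>

text \<open>A simplicial chain is a coefficient function on faces, each face being oriented by the
  linear order of its vertices. The empty face spans the chains of degree -1, so that
  \<open>boundary\<close> in degree 0 is the augmentation map.\<close>

definition chains :: "'a set set \<Rightarrow> int \<Rightarrow> ('a set \<Rightarrow> 'k::field) set" where
  "chains \<Delta> i = {c. \<forall>F. c F \<noteq> 0 \<longrightarrow> F \<in> \<Delta> \<and> face_dim F = i}"

text \<open>If \<open>F = {v\<^sub>0 < \<dots> < v\<^sub>m}\<close>, the face omitting \<open>v\<^sub>j\<close> occurs in the boundary of \<open>F\<close> with sign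
  \<open>(-1) ^ j\<close>. In the formula below \<open>F = insert v G\<close>, and \<open>j\<close> is the number of elements of \<open>G\<close>
  below \<open>v\<close>.\<close>

definition boundary ::
  "'a::linorder set set \<Rightarrow> ('a set \<Rightarrow> 'k::field) \<Rightarrow> ('a set \<Rightarrow> 'k)" where
  "boundary \<Delta> c =
     (\<lambda>G. \<Sum>v | v \<notin> G \<and> insert v G \<in> \<Delta>. (- 1) ^ card {u \<in> G. u < v} * c (insert v G))"

definition cycles :: "'a::linorder set set \<Rightarrow> int \<Rightarrow> ('a set \<Rightarrow> 'k::field) set" where
  "cycles \<Delta> i = {c \<in> chains \<Delta> i. boundary \<Delta> c = (\<lambda>_. 0)}"

definition boundaries :: "'a::linorder set set \<Rightarrow> int \<Rightarrow> ('a set \<Rightarrow> 'k::field) set" where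
  "boundaries \<Delta> i = boundary \<Delta> ` chains \<Delta> (i + 1)"

definition homologous ::
  "'a::linorder set set \<Rightarrow> int \<Rightarrow> (('a set \<Rightarrow> 'k::field) \<times> ('a set \<Rightarrow> 'k)) set" where
  "homologous \<Delta> i =
     {(z, w). z \<in> cycles \<Delta> i \<and> w \<in> cycles \<Delta> i \<and> (\<lambda>F. z F - w F) \<in> boundaries \<Delta> i}"

definition reduced_homology ::
  "'a::linorder set set \<Rightarrow> int \<Rightarrow> ('a set \<Rightarrow> 'k::field) set set" where
  "reduced_homology \<Delta> i = cycles \<Delta> i // homologous \<Delta> i"

text \<open>The quotient space is zero exactly when it has a single element.\<close>

definition homology_vanishes ::
  "'k::field itself \<Rightarrow> 'a::linorder set set \<Rightarrow> int \<Rightarrow> bool" where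
  "homology_vanishes (_ :: 'k itself) \<Delta> i \<longleftrightarrow>
     is_singleton (reduced_homology \<Delta> i :: ('a set \<Rightarrow> 'k) set set)"


section \<open>Properties of pure complexes\<close>

inductive vertex_decomposable :: "'a set set \<Rightarrow> bool" where
  simplex: "facets \<Delta> = {vertices \<Delta>} \<Longrightarrow> vertex_decomposable \<Delta>"
| shed: "pure \<Delta> \<Longrightarrow> x \<in> vertices \<Delta> \<Longrightarrow> vertex_decomposable (link \<Delta> {x}) \<Longrightarrow>
    vertex_decomposable (del \<Delta> {x}) \<Longrightarrow> vertex_decomposable \<Delta>"

lemma vertex_decomposable_imp_pure: "vertex_decomposable \<Delta> \<Longrightarrow> pure \<Delta>"
proof (erule vertex_decomposable.cases)
  show "pure \<Delta>" if "\<Delta> = \<Delta>'" "facets \<Delta>' = {vertices \<Delta>'}" for \<Delta>'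
    using that by (simp add: pure_def)
qed blast

definition shellable :: "'a set set \<Rightarrow> bool" where
  "shellable \<Delta> \<longleftrightarrow> pure \<Delta> \<and>
     (\<exists>Fs. distinct Fs \<and> set Fs = facets \<Delta> \<and>
        (\<forall>i < length Fs. \<forall>j < i. \<exists>x \<in> Fs ! i - Fs ! j. \<exists>l < i. Fs ! i - Fs ! l = {x}))"

definition cohen_macaulay :: "'k::field itself \<Rightarrow> 'a::linorder set set \<Rightarrow> bool" where
  "cohen_macaulay k \<Delta> \<longleftrightarrow> pure \<Delta> \<and>
     (\<forall>F\<in>\<Delta>. \<forall>i < complex_dim (link \<Delta> F). homology_vanishes k (link \<Delta> F) i)"

definition buchsbaum :: "'k::field itself \<Rightarrow> 'a::linorder set set \<Rightarrow> bool" where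
  "buchsbaum k \<Delta> \<longleftrightarrow> pure \<Delta> \<and> (\<forall>x\<in>vertices \<Delta>. cohen_macaulay k (link \<Delta> {x}))"


section \<open>Circulant graphs\<close>

text \<open>A finite simple graph is a pair of a finite vertex set and a set of two-element edges.\<close>

type_synonym 'a graph = "'a set \<times> 'a set set"

definition circulant :: "nat \<Rightarrow> nat set \<Rightarrow> nat graph" where
  "circulant n S =
     ({..<n}, {{x, y} | x y. x < n \<and> y < n \<and> x \<noteq> y \<and>
        (nat \<bar>int x - int y\<bar> \<in> S \<or> n - nat \<bar>int x - int y\<bar> \<in> S)})"

text \<open>For \<open>b = 1\<close> the connection set is empty, so the graph has no edges and its independence
  complex is a simplex, whatever \<open>n\<close> is.\<close>

definition one_paired_circulant :: "nat \<Rightarrow> nat \<Rightarrow> nat \<Rightarrow> nat graph" where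
  "one_paired_circulant n a b = circulant n {d \<in> {1..n div 2}. a dvd d \<and> \<not> a * b dvd d}"

definition independence_complex :: "'a graph \<Rightarrow> 'a set set" where
  "independence_complex G = {F. F \<subseteq> fst G \<and> indep F (snd G)}"

lemma simplicial_complex_independence_complex:
  assumes "finite (fst G)"
  shows "simplicial_complex (independence_complex G)"
proof -
  have "independence_complex G \<subseteq> Pow (fst G)"
    by (auto simp: independence_complex_def)
  then have "finite (independence_complex G)"
    using assms by (meson finite_Pow_iff finite_subset)
  moreover have "finite F \<and> (\<forall>H. H \<subseteq> F \<longrightarrow> H \<in> independence_complex G)"
    if "F \<in> independence_complex G" for F
    using that assms finite_subset[of F "fst G"] smaller_indep[of F "snd G"]
    unfolding independence_complex_def by blast
  moreover have "{} \<in> independence_complex G"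
    by (simp add: independence_complex_def)
  ultimately show ?thesis
    unfolding simplicial_complex_def by blast
qed

end

theory Submission
  imports Defs
begin

text \<open>In a one-paired circulant two vertices are adjacent if and only if they are congruent modulo
  \<open>a\<close> but not modulo \<open>a * b\<close>. The graph is therefore a disjoint union of \<open>a\<close> complete multipartite
  graphs, the residue classes modulo \<open>a\<close>, each with \<open>b\<close> parts, the residue classes modulo \<open>a * b\<close>,
  of size \<open>m = n div (a * b)\<close>. A facet of the independence complex chooses one whole part in every
  component, so the complex is always pure (\<open>pure_if_equal_parts\<close>).

  If \<open>n = a * b\<close>, the parts are single vertices and the faces are the partial transversals of the
  components. Links and deletions of vertices are again complexes of partial transversals, which
  gives vertex decomposability by induction; shellability follows from it in general
  (\<open>vertex_decomposable_imp_shellable\<close>). For the Cohen-Macaulay property, links of faces are again of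
  this kind, so it is enough that the homology of such a complex vanishes below the top dimension.
  This is an induction that splits off the least vertex \<open>x\<close>: either the complex is a cone over \<open>x\<close>, or
  the vanishing for its link and its deletion combines to the vanishing for the complex
  (\<open>homology_vanishes_if_link_del\<close>).

  If \<open>a * b < n\<close>, then \<open>m \<ge> 2\<close> and \<open>b \<ge> 2\<close>. The difference of two facets is a union of parts, hence
  never a single vertex, which excludes every shelling. A face that fills all components but one has
  as its link the disjoint union of \<open>b\<close> simplices of positive dimension, whose homology in degree 0
  does not vanish (\<open>homology_0_disconnected\<close>); so the complex is not Cohen-Macaulay. For \<open>a > 1\<close> this
  face is not empty, so its link is also a link inside the link of a vertex and the complex is
  not Buchsbaum. For \<open>a = 1\<close> the link of a vertex is the simplex on the rest of its part, hence
  Cohen-Macaulay, and the complex is Buchsbaum.\<close>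


section \<open>Facets and links\<close>

lemma simplicial_complex_subset:
  "simplicial_complex \<Delta> \<Longrightarrow> F \<in> \<Delta> \<Longrightarrow> H \<subseteq> F \<Longrightarrow> H \<in> \<Delta>"
  unfolding simplicial_complex_def by blast

lemma simplicial_complex_finite: "simplicial_complex \<Delta> \<Longrightarrow> finite \<Delta>"
  unfolding simplicial_complex_def by blast

lemma simplicial_complex_finite_face: "simplicial_complex \<Delta> \<Longrightarrow> F \<in> \<Delta> \<Longrightarrow> finite F"
  unfolding simplicial_complex_def by blast

lemma face_in_facet:
  assumes "simplicial_complex \<Delta>" "F \<in> \<Delta>"
  obtains E where "E \<in> facets \<Delta>" "F \<subseteq> E"
proof -
  obtain E where E: "E \<in> \<Delta>" "F \<subseteq> E" "\<forall>H\<in>\<Delta>. E \<subseteq> H \<longrightarrow> H = E"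
    using finite_has_maximal2[OF simplicial_complex_finite[OF assms(1)] assms(2)] by metis
  then have "E \<in> facets \<Delta>"
    by (simp add: facets_def)
  then show ?thesis
    using E(2) that by blast
qed

lemma pure_card_facets:
  "pure \<Delta> \<Longrightarrow> E \<in> facets \<Delta> \<Longrightarrow> E' \<in> facets \<Delta> \<Longrightarrow> card E = card E'"
  unfolding pure_def face_dim_def by fastforce

lemma facets_link_iff:
  assumes "simplicial_complex \<Delta>" "F \<in> \<Delta>"
  shows "H \<in> facets (link \<Delta> F) \<longleftrightarrow> F \<inter> H = {} \<and> F \<union> H \<in> facets \<Delta>"
proof
  assume H: "H \<in> facets (link \<Delta> F)"
  then have disj: "F \<inter> H = {}" and face: "F \<union> H \<in> \<Delta>"
    by (auto simp: facets_def link_def)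
  have "K = F \<union> H" if K: "K \<in> \<Delta>" "F \<union> H \<subseteq> K" for K
  proof -
    have "K - F \<in> link \<Delta> F"
      using K simplicial_complex_subset[OF assms(1) K(1), of "K - F"]
      by (auto simp: link_def Un_absorb1)
    moreover have "H \<subseteq> K - F"
      using K disj by blast
    ultimately have "K - F = H"
      using H by (simp add: facets_def)
    then show ?thesis
      using K(2) by auto
  qed
  then show "F \<inter> H = {} \<and> F \<union> H \<in> facets \<Delta>"
    using disj face unfolding facets_def by blast
next
  assume H: "F \<inter> H = {} \<and> F \<union> H \<in> facets \<Delta>"
  then have "H \<in> link \<Delta> F"
    using simplicial_complex_subset[OF assms(1), of "F \<union> H" H] by (auto simp: link_def facets_def)
  moreover have "K = H" if K: "K \<in> link \<Delta> F" "H \<subseteq> K" for K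
  proof -
    have "F \<union> K \<in> \<Delta>" "F \<inter> K = {}"
      using K by (auto simp: link_def)
    moreover have "F \<union> H \<subseteq> F \<union> K"
      using K by blast
    ultimately have "F \<union> K = F \<union> H"
      using H unfolding facets_def by blast
    then show ?thesis
      using H \<open>F \<inter> K = {}\<close> by blast
  qed
  ultimately show "H \<in> facets (link \<Delta> F)"
    by (simp add: facets_def)
qed

lemma pure_link:
  assumes "simplicial_complex \<Delta>" "F \<in> \<Delta>" "pure \<Delta>"
  shows "pure (link \<Delta> F)"
proof -
  have "card H = card H'" if "H \<in> facets (link \<Delta> F)" "H' \<in> facets (link \<Delta> F)" for H H'
  proof -
    have *: "F \<inter> H = {}" "F \<inter> H' = {}" and fac: "F \<union> H \<in> facets \<Delta>" "F \<union> H' \<in> facets \<Delta>"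
      using that facets_link_iff[OF assms(1,2)] by auto
    have "finite (F \<union> H)" "finite (F \<union> H')"
      using fac simplicial_complex_finite_face[OF assms(1)] by (auto simp: facets_def)
    then show ?thesis
      using pure_card_facets[OF assms(3) fac] * by (simp add: card_Un_disjoint)
  qed
  then show ?thesis
    unfolding pure_def face_dim_def by (metis (no_types))
qed

lemma link_link:
  assumes "simplicial_complex \<Delta>" "F \<inter> H = {}"
  shows "link (link \<Delta> F) H = link \<Delta> (F \<union> H)"
proof -
  have sub: "A \<in> \<Delta>" if "B \<in> \<Delta>" "A \<subseteq> B" for A B
    using simplicial_complex_subset[OF assms(1) that] .
  have "F \<union> K \<in> \<Delta> \<and> H \<union> K \<in> \<Delta>" if "F \<union> (H \<union> K) \<in> \<Delta>" for K
    using sub[OF that] by blast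
  then show ?thesis
    unfolding link_def using assms(2) by (simp add: Un_assoc set_eq_iff) blast
qed

text \<open>Links in a link are links in the whole complex.\<close>

lemma cohen_macaulay_link:
  assumes "simplicial_complex \<Delta>" "F \<in> \<Delta>" "cohen_macaulay k \<Delta>"
  shows "cohen_macaulay k (link \<Delta> F)"
proof -
  have "link (link \<Delta> F) H = link \<Delta> (F \<union> H) \<and> F \<union> H \<in> \<Delta>" if "H \<in> link \<Delta> F" for H
    using that link_link[OF assms(1), of F H] by (simp add: link_def)
  then show ?thesis
    using assms pure_link[OF assms(1,2)] unfolding cohen_macaulay_def by auto
qed

lemma cohen_macaulay_imp_buchsbaum:
  "simplicial_complex \<Delta> \<Longrightarrow> cohen_macaulay k \<Delta> \<Longrightarrow> buchsbaum k \<Delta>"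
  unfolding buchsbaum_def vertices_def
  using cohen_macaulay_link cohen_macaulay_def by blast


section \<open>Vertex decomposable complexes are shellable\<close>

text \<open>A shelling of the deletion of \<open>x\<close> can be followed by a shelling of the link, each facet
  enlarged by \<open>x\<close>. A facet \<open>insert x L\<close> of the second part meets the first part in \<open>L\<close>, because
  \<open>L\<close> lies in a facet of the deletion, which is larger by one vertex. If every facet contains \<open>x\<close>,
  the facets of the deletion have too small a dimension and the first part has to be dropped.\<close>

lemma shellable_if_link_del:
  assumes cx: "simplicial_complex \<Delta>" and pure: "pure \<Delta>" and x: "x \<in> vertices \<Delta>"
    and link: "shellable (link \<Delta> {x})" and del: "shellable (del \<Delta> {x})"
  shows "shellable \<Delta>"
proof -
  have face_x: "{x} \<in> \<Delta>"
    using x by (simp add: vertices_def)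
  note fl = facets_link_iff[OF cx face_x]
  have cx_del: "simplicial_complex (del \<Delta> {x})"
    by (rule simplicial_complex_del[OF cx]) simp
  obtain Ls where Ls: "distinct Ls" "set Ls = facets (link \<Delta> {x})"
    "\<forall>i < length Ls. \<forall>j < i. \<exists>y \<in> Ls ! i - Ls ! j. \<exists>l < i. Ls ! i - Ls ! l = {y}"
    using link unfolding shellable_def by blast
  obtain Ds where Ds: "distinct Ds" "set Ds = facets (del \<Delta> {x})"
    "\<forall>i < length Ds. \<forall>j < i. \<exists>y \<in> Ds ! i - Ds ! j. \<exists>l < i. Ds ! i - Ds ! l = {y}"
    using del unfolding shellable_def by blast
  define Ls' where "Ls' = map (insert x) Ls"
  define Ds' where "Ds' = (if \<forall>E\<in>facets \<Delta>. x \<in> E then [] else Ds)"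
  have notin: "x \<notin> L" and in_facets: "insert x L \<in> facets \<Delta>" if "L \<in> set Ls" for L
    using that Ls(2) fl by auto
  have len: "length Ls' = length Ls"
    by (simp add: Ls'_def)
  have set_Ls': "set Ls' = {E \<in> facets \<Delta>. x \<in> E}"
  proof -
    have "E \<in> set Ls'" if E: "E \<in> facets \<Delta>" "x \<in> E" for E
    proof -
      have "E - {x} \<in> set Ls"
        using E Ls(2) fl[of "E - {x}"] by (simp add: insert_absorb)
      then have "insert x (E - {x}) \<in> set Ls'"
        unfolding Ls'_def set_map by (rule imageI)
      then show ?thesis
        using E by (simp add: insert_absorb)
    qed
    then show ?thesis
      using in_facets by (auto simp: Ls'_def)
  qed
  have set_Ds': "set Ds' = {E \<in> facets \<Delta>. x \<notin> E}"
    and del_facets: "facets (del \<Delta> {x}) = {E \<in> facets \<Delta>. x \<notin> E}"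
    if ex: "D \<in> facets \<Delta>" "x \<notin> D" for D
  proof -
    have sub: "E \<in> facets (del \<Delta> {x})" if "E \<in> facets \<Delta>" "x \<notin> E" for E
      using that by (auto simp: facets_def del_def)
    have "E \<in> facets \<Delta>" if E: "E \<in> facets (del \<Delta> {x})" for E
    proof -
      have face: "E \<in> \<Delta>"
        using E by (auto simp: facets_def del_def)
      obtain E' where E': "E' \<in> facets \<Delta>" "E \<subseteq> E'"
        using face_in_facet[OF cx face] .
      have "card E = card D"
        using del E sub[OF ex] unfolding shellable_def by (blast intro: pure_card_facets)
      also have "\<dots> = card E'"
        using pure_card_facets[OF pure] ex E' by blast
      finally have "E = E'"
        using E' card_subset_eq simplicial_complex_finite_face[OF cx, of E']
        by (auto simp: facets_def)
      then show ?thesis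
        using E' by simp
    qed
    moreover have "x \<notin> E" if "E \<in> facets (del \<Delta> {x})" for E
      using that by (auto simp: facets_def del_def)
    ultimately show "facets (del \<Delta> {x}) = {E \<in> facets \<Delta>. x \<notin> E}"
      using sub by blast
    then show "set Ds' = {E \<in> facets \<Delta>. x \<notin> E}"
      using ex Ds(2) by (auto simp: Ds'_def)
  qed
  have set_D: "set Ds' = {E \<in> facets \<Delta>. x \<notin> E}"
  proof (cases "\<forall>E\<in>facets \<Delta>. x \<in> E")
    case True
    then show ?thesis by (auto simp: Ds'_def)
  next
    case False
    then show ?thesis using set_Ds' by blast
  qed
  define Fs where "Fs = Ds' @ Ls'"
  have nth_D: "Fs ! i = Ds' ! i" if "i < length Ds'" for i
    using that by (simp add: Fs_def nth_append)
  have nth_L: "Fs ! (length Ds' + i) = insert x (Ls ! i)" if "i < length Ls" for i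
    using that by (simp add: Fs_def nth_append Ls'_def)
  have "distinct Ls'"
    unfolding Ls'_def distinct_map
  proof
    show "distinct Ls" by (rule Ls)
    show "inj_on (insert x) (set Ls)"
      by (meson inj_onI insert_ident notin)
  qed
  then have "distinct Fs"
    using Ds(1) set_Ls' set_D by (auto simp: Fs_def Ds'_def)
  moreover have "set Fs = facets \<Delta>"
    using set_Ls' set_D by (auto simp: Fs_def)
  moreover have "\<exists>y \<in> Fs ! i - Fs ! j. \<exists>l < i. Fs ! i - Fs ! l = {y}"
    if i: "i < length Fs" and j: "j < i" for i j
  proof (cases "i < length Ds'")
    case True
    then have "Ds' = Ds"
      by (auto simp: Ds'_def split: if_splits)
    then obtain y l where yl: "y \<in> Ds' ! i - Ds' ! j" "l < i" "Ds' ! i - Ds' ! l = {y}"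
      using Ds(3) True j by blast
    then show ?thesis
      using True j by (metis nth_D order.strict_trans)
  next
    case False
    define i' where "i' = i - length Ds'"
    have i': "i = length Ds' + i'" "i' < length Ls"
      using False i by (auto simp: i'_def Fs_def len)
    have L: "Ls ! i' \<in> set Ls"
      using i' by simp
    show ?thesis
    proof (cases "j < length Ds'")
      case True
      have "Ds' ! j \<in> set Ds'"
        using True by simp
      then have ex: "Ds' ! j \<in> facets \<Delta>" "x \<notin> Ds' ! j"
        using set_D by auto
      have "Ls ! i' \<in> del \<Delta> {x}"
        using L notin[OF L] unfolding Ls(2) by (simp add: facets_def link_def del_def)
      then obtain D where D: "D \<in> facets (del \<Delta> {x})" "Ls ! i' \<subseteq> D"
        using face_in_facet[OF cx_del] by blast
      then have D': "D \<in> facets \<Delta>" "x \<notin> D" "D \<in> set Ds'"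
        using del_facets[OF ex] set_D by auto
      obtain l where l: "l < length Ds'" "Ds' ! l = D"
        using D' by (meson in_set_conv_nth)
      have "Fs ! i - Fs ! l = {x}"
        using l i' nth_D nth_L D D' by auto
      moreover have "x \<in> Fs ! i - Fs ! j"
        using i' nth_D nth_L ex True by simp
      moreover have "l < i"
        using l False by simp
      ultimately show ?thesis by blast
    next
      case False
      define j' where "j' = j - length Ds'"
      have j': "j = length Ds' + j'" "j' < i'"
        using False j i' by (auto simp: j'_def)
      obtain y l where yl: "y \<in> Ls ! i' - Ls ! j'" "l < i'" "Ls ! i' - Ls ! l = {y}"
        using Ls(3) i'(2) j'(2) by blast
      have "y \<noteq> x"
        using yl(1) notin[OF L] by blast
      then have "y \<in> Fs ! i - Fs ! j"
        using yl nth_L i' j' by simp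
      moreover have "Fs ! i - Fs ! (length Ds' + l) = {y}"
        using yl nth_L[of i'] nth_L[of l] i' notin[OF L] by (auto simp: insert_Diff_if)
      moreover have "length Ds' + l < i"
        using yl i' by simp
      ultimately show ?thesis by blast
    qed
  qed
  ultimately show ?thesis
    using pure unfolding shellable_def by blast
qed

theorem vertex_decomposable_imp_shellable:
  "vertex_decomposable \<Delta> \<Longrightarrow> simplicial_complex \<Delta> \<Longrightarrow> shellable \<Delta>"
proof (induction rule: vertex_decomposable.induct)
  case (simplex \<Delta>)
  then have "pure \<Delta>"
    by (simp add: pure_def)
  then show ?case
    unfolding shellable_def using simplex by (intro conjI exI[of _ "[vertices \<Delta>]"]) auto
next
  case (shed \<Delta> x)
  then have "simplicial_complex (link \<Delta> {x})" "simplicial_complex (del \<Delta> {x})"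
    by (auto simp: vertices_def intro!: simplicial_complex_link simplicial_complex_del)
  then show ?case
    using shed shellable_if_link_del[of \<Delta> x] by simp
qed


section \<open>Vanishing of reduced homology\<close>

lemma boundary_add: "boundary \<Delta> (\<lambda>F. c F + d F) = (\<lambda>G. boundary \<Delta> c G + boundary \<Delta> d G)"
  by (simp add: boundary_def distrib_left sum.distrib)

lemma boundary_diff: "boundary \<Delta> (\<lambda>F. c F - d F) = (\<lambda>G. boundary \<Delta> c G - boundary \<Delta> d G)"
  by (simp add: boundary_def right_diff_distrib sum_subtractf)

lemma boundary_uminus: "boundary \<Delta> (\<lambda>F. - c F) = (\<lambda>G. - boundary \<Delta> c G)"
  by (simp add: boundary_def sum_negf)

lemma boundary_zero: "boundary \<Delta> (\<lambda>_. 0) = (\<lambda>_. 0)"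
  by (simp add: boundary_def)

lemma zero_in_chains: "(\<lambda>_. 0) \<in> chains \<Delta> i"
  by (simp add: chains_def)

lemma chains_add:
  "c \<in> chains \<Delta> i \<Longrightarrow> d \<in> chains \<Delta> i \<Longrightarrow> (\<lambda>F. c F + d F) \<in> chains \<Delta> i"
  unfolding chains_def mem_Collect_eq by (metis add_cancel_right_left)

lemma chains_uminus: "c \<in> chains \<Delta> i \<Longrightarrow> (\<lambda>F. - c F) \<in> chains \<Delta> i"
  unfolding chains_def by simp

lemma chains_diff:
  "c \<in> chains \<Delta> i \<Longrightarrow> d \<in> chains \<Delta> i \<Longrightarrow> (\<lambda>F. c F - d F) \<in> chains \<Delta> i"
  using chains_add[OF _ chains_uminus] by fastforce

lemma chains_mono: "\<Gamma> \<subseteq> \<Delta> \<Longrightarrow> chains \<Gamma> i \<subseteq> chains \<Delta> i"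
  unfolding chains_def by blast

lemma zero_in_boundaries: "(\<lambda>_. 0) \<in> boundaries \<Delta> i"
  unfolding boundaries_def
  by (rule image_eqI[of _ _ "\<lambda>_. 0"]) (simp_all add: zero_in_chains boundary_zero)

text \<open>If the quotient has a single class, each cycle is homologous to 0, which makes the negative of
  the cycle, and thus the cycle, a boundary.\<close>

theorem homology_vanishes_iff:
  "homology_vanishes TYPE('k::field) \<Delta> i \<longleftrightarrow>
     (cycles \<Delta> i :: ('a::linorder set \<Rightarrow> 'k) set) \<subseteq> boundaries \<Delta> i"
proof
  let ?Z = "cycles \<Delta> i :: ('a set \<Rightarrow> 'k) set"
  have zero: "(\<lambda>_. 0) \<in> ?Z"
    by (simp add: cycles_def zero_in_chains boundary_zero)
  {
    assume "homology_vanishes TYPE('k) \<Delta> i"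
    then obtain Q where Q: "?Z // homologous \<Delta> i = {Q}"
      unfolding homology_vanishes_def reduced_homology_def is_singleton_def by blast
    show "?Z \<subseteq> boundaries \<Delta> i"
    proof
      fix z assume z: "z \<in> ?Z"
      have "homologous \<Delta> i `` {z} = Q" "homologous \<Delta> i `` {\<lambda>_. 0 :: 'k} = Q"
        using quotientI[OF z, of "homologous \<Delta> i"] quotientI[OF zero, of "homologous \<Delta> i"] Q
        by auto
      moreover have "z \<in> homologous \<Delta> i `` {z}"
        using z by (simp add: homologous_def zero_in_boundaries)
      ultimately have "((\<lambda>_. 0), z) \<in> homologous \<Delta> i"
        by auto
      then have "(\<lambda>F. - z F) \<in> boundaries \<Delta> i"
        by (simp add: homologous_def)
      then obtain c where c: "c \<in> chains \<Delta> (i + 1)" "(\<lambda>F. - z F) = boundary \<Delta> c"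
        unfolding boundaries_def by blast
      have "boundary \<Delta> (\<lambda>F. - c F) = z"
        unfolding boundary_uminus c(2)[symmetric] by simp
      then show "z \<in> boundaries \<Delta> i"
        unfolding boundaries_def using chains_uminus[OF c(1)] by blast
    qed
  next
    assume sub: "?Z \<subseteq> boundaries \<Delta> i"
    have "(\<lambda>F. z F - w F) \<in> boundaries \<Delta> i" if "z \<in> ?Z" "w \<in> ?Z" for z w
    proof -
      have "(\<lambda>F. z F - w F) \<in> ?Z"
        using that by (simp add: cycles_def chains_diff boundary_diff)
      then show ?thesis
        using sub by blast
    qed
    then have "homologous \<Delta> i `` {z} = ?Z" if "z \<in> ?Z" for z
      using that by (auto simp: homologous_def)
    then have "?Z // homologous \<Delta> i = {?Z}"
      using zero unfolding quotient_def by blast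
    then show "homology_vanishes TYPE('k) \<Delta> i"
      unfolding homology_vanishes_def reduced_homology_def is_singleton_def by blast
  }
qed

lemma finite_cofaces:
  assumes "finite \<Delta>"
  shows "finite {v. v \<notin> G \<and> insert v G \<in> \<Delta>}"
proof (rule finite_imageD)
  show "finite ((\<lambda>v. insert v G) ` {v. v \<notin> G \<and> insert v G \<in> \<Delta>})"
    by (rule finite_subset[OF _ assms]) blast
  show "inj_on (\<lambda>v. insert v G) {v. v \<notin> G \<and> insert v G \<in> \<Delta>}"
    by (auto simp: inj_on_def)
qed

lemma boundary_subcomplex:
  assumes "finite \<Delta>" "\<Gamma> \<subseteq> \<Delta>" "c \<in> chains \<Gamma> i"
  shows "boundary \<Delta> c = boundary \<Gamma> c"
proof
  fix G
  show "boundary \<Delta> c G = boundary \<Gamma> c G"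
    unfolding boundary_def
    by (rule sum.mono_neutral_right[OF finite_cofaces[OF assms(1)]])
      (use assms(2,3) in \<open>auto simp: chains_def\<close>)
qed

text \<open>The join of \<open>x\<close> with a chain. No sign is attached because \<open>x\<close> will always be the least vertex
  and so comes first in the orientation of every face.\<close>

definition cone :: "'a \<Rightarrow> ('a set \<Rightarrow> 'k::field) \<Rightarrow> ('a set \<Rightarrow> 'k)" where
  "cone x c = (\<lambda>F. if x \<in> F then c (F - {x}) else 0)"

lemma cone_chains:
  assumes "simplicial_complex \<Delta>" "c \<in> chains (link \<Delta> {x}) i"
  shows "cone x c \<in> chains \<Delta> (i + 1)"
proof -
  have "F \<in> \<Delta> \<and> face_dim F = i + 1" if "cone x c F \<noteq> 0" for F
  proof -
    have x: "x \<in> F" and c: "c (F - {x}) \<noteq> 0"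
      using that by (auto simp: cone_def split: if_splits)
    from c have "F - {x} \<in> link \<Delta> {x}" and dim: "face_dim (F - {x}) = i"
      using assms(2) by (auto simp: chains_def)
    then have F: "F \<in> \<Delta>"
      using x by (simp add: link_def insert_absorb)
    have "card F = Suc (card (F - {x}))"
      using card.remove[OF simplicial_complex_finite_face[OF assms(1) F] x] .
    then show ?thesis
      using F dim by (simp add: face_dim_def)
  qed
  then show ?thesis
    by (simp add: chains_def)
qed

text \<open>Since \<open>x\<close> precedes all other vertices, removing it from a face has sign 1, and adding it to a
  face flips the signs of all other removals.\<close>

lemma boundary_cone:
  assumes cx: "simplicial_complex \<Delta>" and min: "\<forall>v\<in>vertices \<Delta>. x \<le> v"
    and c: "c \<in> chains (link \<Delta> {x}) i"
  shows "boundary \<Delta> (cone x c) = (\<lambda>G. c G - cone x (boundary \<Delta> c) G)"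
proof
  fix G
  have zero: "c F = 0" if "x \<in> F \<or> insert x F \<notin> \<Delta>" for F
    using that c by (auto simp: chains_def link_def)
  have le: "x \<le> u" if "F \<in> \<Delta>" "u \<in> F" for F u
  proof -
    have "{u} \<in> \<Delta>"
      using simplicial_complex_subset[OF cx that(1)] that(2) by simp
    then show ?thesis
      using min by (simp add: vertices_def)
  qed
  let ?A = "\<lambda>G. {v. v \<notin> G \<and> insert v G \<in> \<Delta>}"
  let ?s = "\<lambda>v G. (- 1) ^ card {u \<in> G. u < v} :: 'b"
  have fin: "finite (?A H)" for H
    using finite_cofaces[OF simplicial_complex_finite[OF cx]] .
  show "boundary \<Delta> (cone x c) G = c G - cone x (boundary \<Delta> c) G"
  proof (cases "x \<in> G")
    case False
    have "?s v G * cone x c (insert v G) = (if v = x then c G else 0)" if v: "v \<in> ?A G" for v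
    proof (cases "v = x")
      case True
      have "{u \<in> G. u < x} = {}"
        using le[of "insert v G"] v True by (auto simp: not_less)
      then show ?thesis
        unfolding True using False by (simp add: cone_def del: Collect_empty_eq)
    next
      case neq: False
      then show ?thesis
        using False by (simp add: cone_def)
    qed
    then have "boundary \<Delta> (cone x c) G = (\<Sum>v\<in>?A G. if v = x then c G else 0)"
      unfolding boundary_def by (rule sum.cong[OF refl])
    also have "\<dots> = (if x \<in> ?A G then c G else 0)"
      using fin by simp
    also have "\<dots> = c G"
      using zero[of G] False by auto
    finally show ?thesis
      using False by (simp add: cone_def)
  next
    case True
    let ?G = "G - {x}"
    have GG: "insert x (insert v ?G) = insert v G" for v
      using True by blast
    have sub: "?A G \<subseteq> ?A ?G"
      using simplicial_complex_subset[OF cx] by (auto intro: simplicial_complex_subset[OF cx])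
    have "boundary \<Delta> c ?G = (\<Sum>v\<in>?A G. ?s v ?G * c (insert v ?G))"
      unfolding boundary_def
    proof (rule sum.mono_neutral_right[OF fin sub], rule ballI)
      fix v assume v: "v \<in> ?A ?G - ?A G"
      then have "c (insert v ?G) = 0"
        using zero[of "insert v ?G"] GG[of v] by auto
      then show "?s v ?G * c (insert v ?G) = 0"
        by simp
    qed
    also have "\<dots> = (\<Sum>v\<in>?A G. - (?s v G * cone x c (insert v G)))"
    proof (rule sum.cong[OF refl])
      fix v assume v: "v \<in> ?A G"
      then have neq: "v \<noteq> x"
        using True by blast
      have "x < v"
        using le[of "insert v G" v] v neq by auto
      then have "{u \<in> G. u < v} = insert x {u \<in> ?G. u < v}"
        using True by auto
      moreover have "finite {u \<in> ?G. u < v}"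
        using simplicial_complex_finite_face[OF cx, of "insert v G"] v by simp
      ultimately have "card {u \<in> G. u < v} = Suc (card {u \<in> ?G. u < v})"
        by simp
      then have "?s v G = - ?s v ?G"
        by simp
      moreover have "cone x c (insert v G) = c (insert v ?G)"
        using True neq by (simp add: cone_def insert_Diff_if)
      ultimately show "?s v ?G * c (insert v ?G) = - (?s v G * cone x c (insert v G))"
        by simp
    qed
    also have "\<dots> = - boundary \<Delta> (cone x c) G"
      by (simp add: boundary_def sum_negf)
    finally show ?thesis
      using True zero[of G] by (simp add: cone_def)
  qed
qed

text \<open>A cycle is cut into the part \<open>cone x u\<close> on the faces through \<open>x\<close> and the rest \<open>w\<close>. In its
  boundary, the coefficients on faces through \<open>x\<close> show that \<open>u\<close> is a cycle, and the others that
  the boundary of \<open>w\<close> cancels \<open>u\<close>.\<close>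

lemma cycle_split:
  assumes cx: "simplicial_complex \<Delta>" and min: "\<forall>v\<in>vertices \<Delta>. x \<le> v"
    and z: "z \<in> cycles \<Delta> i"
  obtains u w where "u \<in> cycles (link \<Delta> {x}) (i - 1)" "w \<in> chains (del \<Delta> {x}) i"
    "z = (\<lambda>F. cone x u F + w F)" "boundary \<Delta> w = (\<lambda>G. - u G)"
proof -
  define u where "u = (\<lambda>G. if x \<in> G then 0 else z (insert x G))"
  define w where "w = (\<lambda>G. if x \<in> G then 0 else z G)"
  have zc: "z \<in> chains \<Delta> i" and bz: "boundary \<Delta> z G = 0" for G
    using z by (auto simp: cycles_def)
  have zF: "F \<in> \<Delta>" "face_dim F = i" if "z F \<noteq> 0" for F
    using that zc by (auto simp: chains_def)
  have u: "u \<in> chains (link \<Delta> {x}) (i - 1)"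
  proof -
    have "G \<in> link \<Delta> {x} \<and> face_dim G = i - 1" if "u G \<noteq> 0" for G
    proof -
      have x: "x \<notin> G" and "z (insert x G) \<noteq> 0"
        using that by (auto simp: u_def split: if_splits)
      then have G: "insert x G \<in> \<Delta>" "face_dim (insert x G) = i"
        using zF by blast+
      have "finite G"
        using simplicial_complex_finite_face[OF cx G(1)] by simp
      then have "face_dim G = i - 1"
        using G(2) x by (simp add: face_dim_def)
      moreover have "G \<in> link \<Delta> {x}"
        using G(1) x simplicial_complex_subset[OF cx G(1), of G] by (auto simp: link_def)
      ultimately show ?thesis by simp
    qed
    then show ?thesis by (simp add: chains_def)
  qed
  have w: "w \<in> chains (del \<Delta> {x}) i"
    using zF by (auto simp: chains_def w_def del_def split: if_splits)
  have split: "z = (\<lambda>F. cone x u F + w F)"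
    by (auto simp: fun_eq_iff cone_def u_def w_def insert_absorb)
  have "boundary \<Delta> z = (\<lambda>G. u G - cone x (boundary \<Delta> u) G + boundary \<Delta> w G)"
    by (subst split) (simp add: boundary_add boundary_cone[OF cx min u])
  then have eq: "u G - cone x (boundary \<Delta> u) G + boundary \<Delta> w G = 0" for G
    using bz[of G] by simp
  have vanish: "boundary \<Delta> c G = 0" if "x \<in> G" "\<forall>F. x \<in> F \<longrightarrow> c F = 0" for c :: "'a set \<Rightarrow> 'b" and G
    using that by (simp add: boundary_def)
  \<comment> \<open>The faces through \<open>x\<close> in the boundary of \<open>z\<close> come from the cone only.\<close>
  have bu: "boundary \<Delta> u G = 0" for G
  proof (cases "x \<in> G")
    case True
    then show ?thesis
      by (rule vanish) (simp add: u_def)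
  next
    case False
    have "boundary \<Delta> w (insert x G) = 0"
      by (rule vanish) (simp_all add: w_def)
    moreover have "u (insert x G) = 0"
      by (simp add: u_def)
    ultimately show ?thesis
      using eq[of "insert x G"] False by (simp add: cone_def)
  qed
  have "link \<Delta> {x} \<subseteq> \<Delta>"
    by (auto simp: link_def)
  then have "boundary (link \<Delta> {x}) u = boundary \<Delta> u"
    using boundary_subcomplex[OF simplicial_complex_finite[OF cx] _ u] by simp
  then have "u \<in> cycles (link \<Delta> {x}) (i - 1)"
    using u bu by (auto simp: cycles_def)
  moreover have "boundary \<Delta> w = (\<lambda>G. - u G)"
  proof
    fix G
    show "boundary \<Delta> w G = - u G"
      using eq[of G] bu by (simp add: cone_def eq_neg_iff_add_eq_0 add.commute split: if_splits)
  qed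
  ultimately show ?thesis
    using that w split by blast
qed

text \<open>The chain level form of the Mayer-Vietoris argument for \<open>\<Delta>\<close> as the union of the deletion of
  \<open>x\<close> and the star of \<open>x\<close>, which meet in the link of \<open>x\<close>.\<close>

lemma homology_vanishes_if_link_del:
  fixes \<Delta> :: "'a::linorder set set"
  assumes cx: "simplicial_complex \<Delta>" and min: "\<forall>v\<in>vertices \<Delta>. x \<le> v"
    and link: "homology_vanishes TYPE('k::field) (link \<Delta> {x}) (i - 1)"
    and del: "homology_vanishes TYPE('k) (del \<Delta> {x}) i"
  shows "homology_vanishes TYPE('k) \<Delta> i"
  unfolding homology_vanishes_iff
proof
  fix z :: "'a set \<Rightarrow> 'k" assume "z \<in> cycles \<Delta> i"
  then obtain u w where u: "u \<in> cycles (link \<Delta> {x}) (i - 1)" and w: "w \<in> chains (del \<Delta> {x}) i"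
    and z: "z = (\<lambda>F. cone x u F + w F)" and bw: "boundary \<Delta> w = (\<lambda>G. - u G)"
    using cycle_split[OF cx min] by blast
  have subs: "link \<Delta> {x} \<subseteq> del \<Delta> {x}" "link \<Delta> {x} \<subseteq> \<Delta>" "del \<Delta> {x} \<subseteq> \<Delta>"
    by (auto simp: link_def del_def)
  note sub = boundary_subcomplex[OF simplicial_complex_finite[OF cx]]
  obtain t where t: "t \<in> chains (link \<Delta> {x}) i" "boundary \<Delta> t = u"
    using link u sub[OF subs(2)] unfolding homology_vanishes_iff boundaries_def by force
  have wt: "(\<lambda>F. w F + t F) \<in> chains (del \<Delta> {x}) i"
    using chains_add[OF w] t(1) chains_mono[OF subs(1)] by blast
  moreover have "boundary \<Delta> (\<lambda>F. w F + t F) = (\<lambda>_. 0)"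
    by (simp add: boundary_add bw t(2))
  ultimately have "(\<lambda>F. w F + t F) \<in> cycles (del \<Delta> {x}) i"
    using sub[OF subs(3) wt] by (simp add: cycles_def)
  then obtain s where s: "s \<in> chains (del \<Delta> {x}) (i + 1)" "boundary \<Delta> s = (\<lambda>F. w F + t F)"
    using del sub[OF subs(3)] unfolding homology_vanishes_iff boundaries_def by force
  have "boundary \<Delta> (\<lambda>F. s F - cone x t F) = z"
    by (simp add: boundary_diff s(2) boundary_cone[OF cx min t(1)] t(2) z add.commute)
  moreover have "(\<lambda>F. s F - cone x t F) \<in> chains \<Delta> (i + 1)"
    using chains_diff[of s] s(1) chains_mono[OF subs(3)] cone_chains[OF cx t(1)] by blast
  ultimately show "z \<in> boundaries \<Delta> i"
    unfolding boundaries_def by blast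
qed

text \<open>The part of a cycle away from the apex determines the rest of it, and the join of that part
  with the apex has the cycle as its boundary.\<close>

lemma homology_vanishes_cone:
  fixes \<Delta> :: "'a::linorder set set"
  assumes cx: "simplicial_complex \<Delta>" and min: "\<forall>v\<in>vertices \<Delta>. x \<le> v"
    and apex: "\<forall>F\<in>\<Delta>. insert x F \<in> \<Delta>"
  shows "homology_vanishes TYPE('k::field) \<Delta> i"
  unfolding homology_vanishes_iff
proof
  fix z :: "'a set \<Rightarrow> 'k" assume "z \<in> cycles \<Delta> i"
  then obtain u w where w: "w \<in> chains (del \<Delta> {x}) i"
    and z: "z = (\<lambda>F. cone x u F + w F)" and bw: "boundary \<Delta> w = (\<lambda>G. - u G)"
    using cycle_split[OF cx min] by blast
  have "del \<Delta> {x} = link \<Delta> {x}"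
    using apex by (auto simp: link_def del_def)
  then have w': "w \<in> chains (link \<Delta> {x}) i"
    using w by simp
  have "boundary \<Delta> (cone x w) = z"
    unfolding boundary_cone[OF cx min w'] bw z by (auto simp: cone_def)
  then show "z \<in> boundaries \<Delta> i"
    unfolding boundaries_def using cone_chains[OF cx w'] by blast
qed

text \<open>The sum of the coefficients on the vertices in \<open>A\<close> kills every boundary if no edge leaves
  \<open>A\<close>, but it does not kill the difference of a vertex inside and one outside.\<close>

lemma homology_0_disconnected:
  fixes \<Delta> :: "'a::linorder set set"
  assumes cx: "simplicial_complex \<Delta>" and x: "{x} \<in> \<Delta>" "x \<in> A" and y: "{y} \<in> \<Delta>" "y \<notin> A"
    and sep: "\<And>u v. {u, v} \<in> \<Delta> \<Longrightarrow> u \<in> A \<Longrightarrow> v \<in> A"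
  shows "\<not> homology_vanishes TYPE('k::field) \<Delta> 0"
proof
  let ?\<phi> = "\<lambda>c :: 'a set \<Rightarrow> 'k. \<Sum>v\<in>A \<inter> vertices \<Delta>. c {v}"
  let ?V = "vertices \<Delta>"
  have finV: "finite ?V"
    using finite_cofaces[OF simplicial_complex_finite[OF cx], of "{}"] by (simp add: vertices_def)
  define z :: "'a set \<Rightarrow> 'k" where
    "z = (\<lambda>F. if F = {x} then 1 else if F = {y} then - 1 else 0)"
  have xy: "x \<noteq> y"
    using x y by auto
  have chain: "z \<in> chains \<Delta> 0"
    using x y by (auto simp: chains_def z_def face_dim_def split: if_splits)
  have "boundary \<Delta> z G = 0" for G
  proof (cases "G = {}")
    case True
    have "boundary \<Delta> z G = (\<Sum>v\<in>?V. z {v})"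
      by (simp add: boundary_def True vertices_def)
    also have "\<dots> = (\<Sum>v\<in>{x, y}. z {v})"
      by (rule sum.mono_neutral_right[OF finV]) (use x y in \<open>auto simp: vertices_def z_def\<close>)
    also have "\<dots> = 0"
      using xy by (simp add: z_def)
    finally show ?thesis .
  next
    case False
    then have "v \<notin> G \<Longrightarrow> z (insert v G) = 0" for v
      by (auto simp: z_def)
    then show ?thesis
      by (simp add: boundary_def)
  qed
  then have "z \<in> cycles \<Delta> 0"
    using chain by (auto simp: cycles_def)
  moreover assume "homology_vanishes TYPE('k) \<Delta> 0"
  ultimately obtain c where c: "c \<in> chains \<Delta> 1" "z = boundary \<Delta> c"
    unfolding homology_vanishes_iff boundaries_def by auto
  have "?\<phi> z = (\<Sum>v\<in>A \<inter> ?V. if v = x then 1 else 0)"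
    by (rule sum.cong) (use y in \<open>auto simp: z_def\<close>)
  also have "\<dots> = 1"
    using x finV by (simp add: vertices_def)
  finally have one: "?\<phi> z = 1" .
  \<comment> \<open>Each edge inside \<open>A\<close> is counted once from either end, with opposite signs.\<close>
  let ?E = "{(u, v). u \<in> A \<and> v \<in> A \<and> u \<noteq> v \<and> {u, v} \<in> \<Delta>}"
  let ?s = "\<lambda>u v. if u < v then - c {u, v} else c {u, v}"
  have vert: "u \<in> ?V" if "{u, v} \<in> \<Delta>" for u v
    using simplicial_complex_subset[OF cx that, of "{u}"] by (simp add: vertices_def)
  have E: "?E = (SIGMA u:A \<inter> ?V. {v. v \<noteq> u \<and> {v, u} \<in> \<Delta>})"
    using vert sep by (auto simp: insert_commute)
  have "?\<phi> z = (\<Sum>u\<in>A \<inter> ?V. \<Sum>v | v \<noteq> u \<and> {v, u} \<in> \<Delta>. ?s u v)"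
  proof (rule sum.cong[OF refl])
    fix u :: 'a
    have "{w. w = u \<and> w < v} = (if u < v then {u} else {})" for v
      by auto
    then show "z {u} = (\<Sum>v | v \<noteq> u \<and> {v, u} \<in> \<Delta>. ?s u v)"
      unfolding c(2) boundary_def by (intro sum.cong) (auto simp: insert_commute)
  qed
  also have "\<dots> = (\<Sum>(u, v)\<in>?E. ?s u v)"
    unfolding E
  proof (rule sum.Sigma)
    show "\<forall>u\<in>A \<inter> ?V. finite {v. v \<noteq> u \<and> {v, u} \<in> \<Delta>}"
      using finite_cofaces[OF simplicial_complex_finite[OF cx], of "{u}" for u] by simp
  qed (use finV in simp)
  finally have \<phi>: "?\<phi> z = (\<Sum>(u, v)\<in>?E. ?s u v)" .
  let ?L = "{(u, v). (u, v) \<in> ?E \<and> u < v}"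
  have split: "?E = ?L \<union> prod.swap ` ?L"
    by (force simp: insert_commute image_iff not_less)
  have "finite ?E"
    by (rule finite_subset[of _ "?V \<times> ?V"]) (use vert finV in \<open>fastforce simp: insert_commute\<close>)+
  then have finL: "finite ?L"
    by (rule rev_finite_subset) auto
  have "(\<Sum>(u, v)\<in>?E. ?s u v) = (\<Sum>(u, v)\<in>?L. ?s u v) + (\<Sum>(u, v)\<in>prod.swap ` ?L. ?s u v)"
    by (subst split, rule sum.union_disjoint) (use finL in auto)
  also have "(\<Sum>(u, v)\<in>prod.swap ` ?L. ?s u v) = (\<Sum>(u, v)\<in>?L. ?s v u)"
    by (subst sum.reindex) (auto simp: inj_on_def intro!: sum.cong)
  also have "(\<Sum>(u, v)\<in>?L. ?s u v) + \<dots> = 0"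
    unfolding sum.distrib[symmetric]
    by (rule sum.neutral) (auto simp: insert_commute)
  finally show False
    using one \<phi> by simp
qed


section \<open>Complexes of partial transversals\<close>

definition transversal_complex :: "('a \<Rightarrow> 'b) \<Rightarrow> 'a set \<Rightarrow> 'a set set" where
  "transversal_complex p V = {F. F \<subseteq> V \<and> inj_on p F}"

lemma simplicial_complex_transversal:
  assumes "finite V"
  shows "simplicial_complex (transversal_complex p V)"
proof -
  have "finite (transversal_complex p V)"
    by (rule finite_subset[of _ "Pow V"]) (use assms in \<open>auto simp: transversal_complex_def\<close>)
  then show ?thesis
    using assms finite_subset
    by (auto simp: simplicial_complex_def transversal_complex_def intro: inj_on_subset)
qed

lemma vertices_transversal: "vertices (transversal_complex p V) = V"
  by (auto simp: vertices_def transversal_complex_def)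

lemma facets_transversal:
  assumes "F \<in> facets (transversal_complex p V)"
  shows "F \<subseteq> V" "inj_on p F" "p ` F = p ` V"
proof -
  have F: "F \<in> transversal_complex p V"
    and max: "\<And>H. H \<in> transversal_complex p V \<Longrightarrow> F \<subseteq> H \<Longrightarrow> H = F"
    using assms by (auto simp: facets_def)
  show sub: "F \<subseteq> V" and inj: "inj_on p F"
    using F by (auto simp: transversal_complex_def)
  have "p v \<in> p ` F" if "v \<in> V" for v
  proof (rule ccontr)
    assume v: "p v \<notin> p ` F"
    then have "insert v F \<in> transversal_complex p V"
      using sub inj that by (auto simp: transversal_complex_def)
    then have "insert v F = F"
      using max by blast
    then show False
      using v by blast
  qed
  then show "p ` F = p ` V"
    using sub by blast
qed

lemma pure_transversal: "pure (transversal_complex p V)"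
proof -
  have "card F = card (p ` V)" if "F \<in> facets (transversal_complex p V)" for F
    using facets_transversal[OF that] card_image by metis
  then show ?thesis
    by (auto simp: pure_def face_dim_def)
qed

lemma link_transversal:
  assumes "F \<in> transversal_complex p V"
  shows "link (transversal_complex p V) F = transversal_complex p {v \<in> V. p v \<notin> p ` F}"
proof (intro set_eqI iffI)
  fix H assume "H \<in> link (transversal_complex p V) F"
  then have disj: "F \<inter> H = {}" and H: "H \<subseteq> V" "inj_on p H" and inj: "inj_on p (F \<union> H)"
    by (auto simp: link_def transversal_complex_def)
  have "p ` F \<inter> p ` H = {}"
    using inj disj by (auto simp: inj_on_def)
  then show "H \<in> transversal_complex p {v \<in> V. p v \<notin> p ` F}"
    using H by (auto simp: transversal_complex_def)
next
  fix H assume H: "H \<in> transversal_complex p {v \<in> V. p v \<notin> p ` F}"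
  then have sub: "H \<subseteq> V" and inj: "inj_on p H" and disj: "\<forall>v\<in>H. p v \<notin> p ` F"
    by (auto simp: transversal_complex_def)
  have "inj_on p (F \<union> H)"
    unfolding inj_on_Un using assms inj disj by (auto simp: transversal_complex_def) (metis imageI)
  then show "H \<in> link (transversal_complex p V) F"
    using assms sub inj disj by (auto simp: link_def transversal_complex_def)
qed

lemma link_vertex_transversal:
  "x \<in> V \<Longrightarrow> link (transversal_complex p V) {x} = transversal_complex p {v \<in> V. p v \<noteq> p x}"
  by (subst link_transversal) (auto simp: transversal_complex_def)

lemma del_vertex_transversal:
  "del (transversal_complex p V) {x} = transversal_complex p (V - {x})"
  by (auto simp: del_def transversal_complex_def)

text \<open>Any vertex can be shed: its link and its deletion are again complexes of partial transversals,
  and all these complexes are pure. The induction ends at the simplex, where no two vertices share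
  a colour.\<close>

theorem vertex_decomposable_transversal:
  "finite V \<Longrightarrow> vertex_decomposable (transversal_complex p V)"
proof (induction V rule: finite_psubset_induct)
  case (psubset V)
  show ?case
  proof (cases "inj_on p V")
    case True
    then have "facets (transversal_complex p V) = {V}"
      by (auto simp: facets_def transversal_complex_def intro: inj_on_subset)
    then show ?thesis
      by (intro vertex_decomposable.simplex) (simp add: vertices_transversal)
  next
    case False
    then obtain x where x: "x \<in> V"
      by (auto simp: inj_on_def)
    show ?thesis
    proof (rule vertex_decomposable.shed[OF pure_transversal])
      show "x \<in> vertices (transversal_complex p V)"
        using x by (simp add: vertices_transversal)
      show "vertex_decomposable (link (transversal_complex p V) {x})"
        unfolding link_vertex_transversal[OF x] by (rule psubset.IH) (use x in blast)
      show "vertex_decomposable (del (transversal_complex p V) {x})"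
        unfolding del_vertex_transversal by (rule psubset.IH) (use x in blast)
    qed
  qed
qed

text \<open>Induction on the number of vertices, splitting off the least vertex \<open>x\<close>. If another vertex has
  the colour of \<open>x\<close>, deleting \<open>x\<close> preserves the dimension, and the dimension of the link is smaller
  by one; otherwise the complex is a cone with apex \<open>x\<close>.\<close>

lemma homology_vanishes_transversal:
  fixes V :: "'a::linorder set"
  assumes "finite V" "i < int (card (p ` V)) - 1"
  shows "homology_vanishes TYPE('k::field) (transversal_complex p V) i"
  using assms
proof (induction V arbitrary: i rule: finite_psubset_induct)
  case (psubset V)
  let ?T = "transversal_complex p V"
  have cx: "simplicial_complex ?T"
    by (rule simplicial_complex_transversal[OF psubset.hyps])
  show ?case
  proof (cases "V = {}")
    case True
    have "z = (\<lambda>_. 0)" if "z \<in> chains ?T i" for z :: "'a set \<Rightarrow> 'k"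
      using that psubset.prems True by (force simp: chains_def face_dim_def fun_eq_iff)
    then have "cycles ?T i \<subseteq> {\<lambda>_. 0 :: 'k}"
      by (auto simp: cycles_def)
    moreover have "(\<lambda>_. 0 :: 'k) \<in> boundaries ?T i"
      by (rule zero_in_boundaries)
    ultimately show ?thesis
      unfolding homology_vanishes_iff by blast
  next
    case False
    define x where "x = Min V"
    have x: "x \<in> V" and min: "\<forall>v\<in>vertices ?T. x \<le> v"
      using False psubset.hyps by (auto simp: x_def vertices_transversal)
    show ?thesis
    proof (cases "\<exists>y\<in>V. y \<noteq> x \<and> p y = p x")
      case True
      have "p ` {v \<in> V. p v \<noteq> p x} = p ` V - {p x}"
        by auto
      then have "card (p ` V) = Suc (card (p ` {v \<in> V. p v \<noteq> p x}))"
        using card.remove[of "p ` V" "p x"] x psubset.hyps by simp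
      then have "homology_vanishes TYPE('k) (link ?T {x}) (i - 1)"
        unfolding link_vertex_transversal[OF x] using x psubset.prems
        by (intro psubset.IH) auto
      moreover have "p ` (V - {x}) = p ` V"
        using True x by (auto simp: image_iff) (metis Diff_iff singletonD)
      then have "homology_vanishes TYPE('k) (del ?T {x}) i"
        unfolding del_vertex_transversal using x psubset.prems
        by (intro psubset.IH) auto
      ultimately show ?thesis
        using homology_vanishes_if_link_del[OF cx min] by blast
    next
      case False
      have "insert x F \<in> ?T" if "F \<in> ?T" for F
        using that x False by (auto simp: transversal_complex_def inj_on_insert)
      then show ?thesis
        using homology_vanishes_cone[OF cx min] by blast
    qed
  qed
qed

theorem cohen_macaulay_transversal:
  fixes V :: "'a::linorder set"
  assumes fin: "finite V"
  shows "cohen_macaulay TYPE('k::field) (transversal_complex p V)"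
proof -
  have dim: "complex_dim (transversal_complex p W) \<le> int (card (p ` W)) - 1" if "finite W" for W :: "'a set"
  proof -
    have "face_dim F \<le> int (card (p ` W)) - 1" if "F \<in> transversal_complex p W" for F
    proof -
      have "card F = card (p ` F)"
        using that by (simp add: transversal_complex_def card_image)
      also have "\<dots> \<le> card (p ` W)"
        using that \<open>finite W\<close> by (intro card_mono) (auto simp: transversal_complex_def)
      finally show ?thesis
        by (simp add: face_dim_def)
    qed
    moreover have "finite (transversal_complex p W)" "transversal_complex p W \<noteq> {}"
      using simplicial_complex_transversal[OF that, of p] by (auto simp: simplicial_complex_def)
    ultimately show ?thesis
      unfolding complex_dim_def by (intro Max.boundedI) auto
  qed
  have "homology_vanishes TYPE('k) (link (transversal_complex p V) F) i"
    if "F \<in> transversal_complex p V" "i < complex_dim (link (transversal_complex p V) F)" for F i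
    using that fin dim[of "{v \<in> V. p v \<notin> p ` F}"]
    by (auto simp: link_transversal intro!: homology_vanishes_transversal)
  then show ?thesis
    by (simp add: cohen_macaulay_def pure_transversal)
qed


section \<open>Independent sets in a disjoint union of complete multipartite graphs\<close>

text \<open>The parts are the fibres of \<open>q\<close>; the complete multipartite components are the fibres of the
  coarser map \<open>p\<close>. A face picks vertices from at most one part of each component.\<close>

definition multipartite_complex :: "('a \<Rightarrow> 'b) \<Rightarrow> ('a \<Rightarrow> 'c) \<Rightarrow> 'a set \<Rightarrow> 'a set set" where
  "multipartite_complex p q V = {F. F \<subseteq> V \<and> (\<forall>x\<in>F. \<forall>y\<in>F. p x = p y \<longrightarrow> q x = q y)}"

lemma multipartite_eq_transversal:
  assumes "inj_on q V"
  shows "multipartite_complex p q V = transversal_complex p V"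
proof -
  have "q x = q y \<longleftrightarrow> x = y" if "F \<subseteq> V" "x \<in> F" "y \<in> F" for F x y
    using inj_on_eq_iff[OF assms, of x y] that by blast
  then show ?thesis
    unfolding multipartite_complex_def transversal_complex_def inj_on_def by blast
qed

locale multipartite =
  fixes p :: "'a \<Rightarrow> 'b" and q :: "'a \<Rightarrow> 'c" and V :: "'a set"
  assumes finite_V: "finite V"
    and refines: "x \<in> V \<Longrightarrow> y \<in> V \<Longrightarrow> q x = q y \<Longrightarrow> p x = p y"
begin

abbreviation "\<Delta> \<equiv> multipartite_complex p q V"

lemma simplicial: "simplicial_complex \<Delta>"
proof -
  have "finite \<Delta>"
    by (rule finite_subset[of _ "Pow V"]) (use finite_V in \<open>auto simp: multipartite_complex_def\<close>)
  then show ?thesis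
    unfolding simplicial_complex_def multipartite_complex_def
    using finite_V finite_subset by blast
qed

lemma singleton_face: "x \<in> V \<Longrightarrow> {x} \<in> \<Delta>"
  by (simp add: multipartite_complex_def)

lemma face_subset: "F \<in> \<Delta> \<Longrightarrow> F \<subseteq> V"
  unfolding multipartite_complex_def by blast

lemma facet_subset: "E \<in> facets \<Delta> \<Longrightarrow> E \<subseteq> V"
  using face_subset unfolding facets_def by blast

lemma face_part:
  "F \<in> \<Delta> \<Longrightarrow> x \<in> F \<Longrightarrow> y \<in> F \<Longrightarrow> p x = p y \<Longrightarrow> q x = q y"
  unfolding multipartite_complex_def by blast

lemma insert_face:
  assumes "F \<in> \<Delta>" "y \<in> V" "\<And>x. x \<in> F \<Longrightarrow> p x = p y \<Longrightarrow> q x = q y"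
  shows "insert y F \<in> \<Delta>"
proof -
  have "q u = q v" if "u \<in> insert y F" "v \<in> insert y F" "p u = p v" for u v
    using that face_part[OF assms(1), of u v] assms(3)[of u] assms(3)[of v] by auto
  moreover have "insert y F \<subseteq> V"
    using assms(1,2) unfolding multipartite_complex_def by blast
  ultimately show ?thesis
    unfolding multipartite_complex_def by blast
qed

lemma facet_part: "E \<in> facets \<Delta> \<Longrightarrow> x \<in> E \<Longrightarrow> y \<in> E \<Longrightarrow> p x = p y \<Longrightarrow> q x = q y"
  using face_part unfolding facets_def by blast

lemma facet_saturated:
  assumes E: "E \<in> facets \<Delta>" and x: "x \<in> E" and y: "y \<in> V" "q y = q x"
  shows "y \<in> E"
proof -
  have "x \<in> V"
    using E x facet_subset by blast
  then have py: "p y = p x"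
    using refines y by blast
  have "insert y E \<in> \<Delta>"
  proof (rule insert_face)
    show "E \<in> \<Delta>"
      using E by (simp add: facets_def)
    show "q z = q y" if "z \<in> E" "p z = p y" for z
      using facet_part[OF E that(1) x] that(2) py y(2) by simp
  qed (rule y)
  then have "insert y E = E"
    using E unfolding facets_def by blast
  then show ?thesis by blast
qed

lemma facet_image:
  assumes E: "E \<in> facets \<Delta>"
  shows "p ` E = p ` V"
proof -
  have "p v \<in> p ` E" if v: "v \<in> V" for v
  proof (rule ccontr)
    assume no: "p v \<notin> p ` E"
    then have "insert v E \<in> \<Delta>"
      using E v by (intro insert_face) (auto simp: facets_def image_iff)
    then have "insert v E = E"
      using E unfolding facets_def by blast
    then show False
      using no by blast
  qed
  then show ?thesis
    using facet_subset[OF E] by blast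
qed

text \<open>A facet consists of one whole part from each component.\<close>

lemma pure_if_equal_parts:
  assumes parts: "\<And>x. x \<in> V \<Longrightarrow> card {y \<in> V. q y = q x} = m"
  shows "pure \<Delta>"
proof -
  have "card E = m * card (p ` V)" if E: "E \<in> facets \<Delta>" for E
  proof -
    have fin: "finite E"
      using facet_subset[OF E] finite_V finite_subset by blast
    have "card {y \<in> E. p y = c} = m" if "c \<in> p ` E" for c
    proof -
      obtain x where x: "x \<in> E" "p x = c"
        using \<open>c \<in> p ` E\<close> by (metis imageE)
      have xV: "x \<in> V"
        using x facet_subset[OF E] by blast
      have "y \<in> E \<and> p y = c \<longleftrightarrow> y \<in> V \<and> q y = q x" for y
      proof
        show "y \<in> V \<and> q y = q x" if "y \<in> E \<and> p y = c"
          using facet_part[OF E, of y x] facet_subset[OF E] x that by auto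
        show "y \<in> E \<and> p y = c" if "y \<in> V \<and> q y = q x"
          using facet_saturated[OF E x(1), of y] refines[OF _ xV, of y] x(2) that by auto
      qed
      then show ?thesis
        using parts[OF xV] by simp
    qed
    then have "(\<Sum>c\<in>p ` E. card {y \<in> E. p y = c}) = m * card (p ` E)"
      by simp
    moreover have "(\<Sum>c\<in>p ` E. card {y \<in> E. p y = c}) = card E"
      using sum.image_gen[OF fin, of "\<lambda>_. 1 :: nat" p] by simp
    ultimately show ?thesis
      using facet_image[OF E] by simp
  qed
  then show ?thesis
    by (simp add: pure_def face_dim_def)
qed

end

text \<open>What obstructs shellability and the Cohen-Macaulay property: a component that offers a choice of
  parts, while changing the choice replaces several vertices at once.\<close>

locale thick_multipartite = multipartite +
  fixes x\<^sub>0 y\<^sub>0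
  assumes thick: "x \<in> V \<Longrightarrow> \<exists>x'\<in>V. x' \<noteq> x \<and> q x' = q x"
    and x\<^sub>0: "x\<^sub>0 \<in> V" and y\<^sub>0: "y\<^sub>0 \<in> V" and same_p: "p x\<^sub>0 = p y\<^sub>0" and diff_q: "q x\<^sub>0 \<noteq> q y\<^sub>0"
begin

text \<open>The difference of two facets is a union of parts, hence never a single vertex.\<close>

theorem not_shellable: "\<not> shellable \<Delta>"
proof
  assume "shellable \<Delta>"
  then obtain Fs where set: "set Fs = facets \<Delta>"
    and shell: "\<forall>i < length Fs. \<forall>j < i. \<exists>x \<in> Fs ! i - Fs ! j. \<exists>l < i. Fs ! i - Fs ! l = {x}"
    unfolding shellable_def by blast
  obtain E E' where E: "E \<in> facets \<Delta>" "x\<^sub>0 \<in> E" and E': "E' \<in> facets \<Delta>" "y\<^sub>0 \<in> E'"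
    using face_in_facet[OF simplicial singleton_face[OF x\<^sub>0]]
      face_in_facet[OF simplicial singleton_face[OF y\<^sub>0]] by (metis insert_subset)
  have "E \<noteq> E'"
    using E E' facet_part same_p diff_q by blast
  then have "1 < length Fs"
    using E E' set by (cases Fs; cases "tl Fs") auto
  then obtain x l where l: "l < 1" "Fs ! 1 - Fs ! l = {x}"
    using shell by (metis zero_less_one)
  have F: "Fs ! 1 \<in> facets \<Delta>" "Fs ! l \<in> facets \<Delta>"
    using \<open>1 < length Fs\<close> l(1) set by (metis nth_mem order.strict_trans)+
  have x: "x \<in> Fs ! 1" "x \<notin> Fs ! l" "x \<in> V"
    using l(2) facet_subset[OF F(1)] by auto
  then obtain x' where x': "x' \<in> V" "x' \<noteq> x" "q x' = q x"
    using thick by blast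
  then have "x' \<in> Fs ! 1" "x' \<notin> Fs ! l"
    using facet_saturated[OF F(1), of x x'] facet_saturated[OF F(2), of x' x] x by auto
  then show False
    using l(2) x' by blast
qed

text \<open>All components except that of \<open>x\<^sub>0\<close> are filled by a face. What remains as its link is a
  disjoint union of simplices, one on each part of the component of \<open>x\<^sub>0\<close>.\<close>

lemma link_single_component:
  obtains F where "F \<in> \<Delta>" "p ` F = p ` V - {p x\<^sub>0}"
    "link \<Delta> F = {H. H \<subseteq> {v \<in> V. p v = p x\<^sub>0} \<and> (\<forall>x\<in>H. \<forall>y\<in>H. q x = q y)}"
proof -
  obtain E where E: "E \<in> facets \<Delta>"
    using face_in_facet[OF simplicial singleton_face[OF x\<^sub>0]] by blast
  define F where "F = {e \<in> E. p e \<noteq> p x\<^sub>0}"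
  have E_face: "E \<in> \<Delta>"
    using E by (simp add: facets_def)
  then have F: "F \<in> \<Delta>"
    by (rule simplicial_complex_subset[OF simplicial]) (simp add: F_def)
  have pF: "p ` F = p ` V - {p x\<^sub>0}"
  proof -
    have "p ` F = p ` E - {p x\<^sub>0}"
      by (auto simp: F_def)
    then show ?thesis
      by (simp add: facet_image[OF E])
  qed
  have "p v = p x\<^sub>0" if H: "H \<in> link \<Delta> F" and v: "v \<in> H" for H v
  proof (rule ccontr)
    assume neq: "p v \<noteq> p x\<^sub>0"
    have vV: "v \<in> V" and disj: "v \<notin> F" and FH: "F \<union> H \<in> \<Delta>"
      using H v face_subset unfolding link_def by blast+
    have "p v \<in> p ` F"
      using pF vV neq by blast
    then obtain e where e: "e \<in> F" "p e = p v"
      by (metis imageE)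
    then have "q v = q e"
      using face_part[OF FH, of v e] v by simp
    then have "v \<in> E"
      using facet_saturated[OF E, of e v] e vV by (simp add: F_def)
    then show False
      using neq disj by (simp add: F_def)
  qed
  moreover have "H \<in> link \<Delta> F"
    if "H \<subseteq> {v \<in> V. p v = p x\<^sub>0}" "\<forall>x\<in>H. \<forall>y\<in>H. q x = q y" for H
  proof -
    have neq: "p f \<noteq> p h" if "f \<in> F" "h \<in> H" for f h
    proof -
      have "p h = p x\<^sub>0"
        using \<open>H \<subseteq> _\<close> \<open>h \<in> H\<close> by blast
      then show ?thesis
        using \<open>f \<in> F\<close> by (simp add: F_def)
    qed
    then have "F \<inter> H = {}"
      by blast
    moreover have "q u = q v" if "u \<in> F \<union> H" "v \<in> F \<union> H" "p u = p v" for u v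
    proof (cases "u \<in> H")
      case True
      then have "v \<in> H"
        using that neq[of v u] by auto
      then show ?thesis
        using True \<open>\<forall>x\<in>H. \<forall>y\<in>H. q x = q y\<close> by blast
    next
      case False
      then have "u \<in> F" "v \<in> F"
        using that neq[of u v] by auto
      then show ?thesis
        using face_part[OF F] that by blast
    qed
    moreover have "F \<subseteq> V" "H \<subseteq> V"
      using face_subset[OF F] that by auto
    ultimately show ?thesis
      using that(2) unfolding link_def multipartite_complex_def by blast
  qed
  moreover have "q x = q y" if "H \<in> link \<Delta> F" "x \<in> H" "y \<in> H" "p x = p y" for H x y
    using face_part[of H x y] that unfolding link_def by blast
  moreover have "H \<subseteq> V" if "H \<in> link \<Delta> F" for H
    using that face_subset unfolding link_def by blast
  ultimately have iff: "H \<in> link \<Delta> F \<longleftrightarrow>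
      H \<subseteq> {v \<in> V. p v = p x\<^sub>0} \<and> (\<forall>x\<in>H. \<forall>y\<in>H. q x = q y)" for H
    by (smt (verit, best) mem_Collect_eq subset_iff)
  have "link \<Delta> F = {H. H \<subseteq> {v \<in> V. p v = p x\<^sub>0} \<and> (\<forall>x\<in>H. \<forall>y\<in>H. q x = q y)}"
    by (rule set_eqI) (simp only: iff mem_Collect_eq)
  then show ?thesis
    using that[OF F pF] by blast
qed

end

text \<open>The linear order of the vertices orients the faces, as homology requires.\<close>

locale ordered_thick_multipartite = thick_multipartite p q V x\<^sub>0 y\<^sub>0
  for p :: "'a::linorder \<Rightarrow> 'b" and q :: "'a \<Rightarrow> 'c" and V x\<^sub>0 y\<^sub>0
begin

lemma disconnected_link:
  obtains F where "F \<in> \<Delta>" "p ` F = p ` V - {p x\<^sub>0}"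
    "0 < complex_dim (link \<Delta> F)" "\<not> homology_vanishes TYPE('k::field) (link \<Delta> F) 0"
proof -
  let ?\<Gamma> = "{H. H \<subseteq> {v \<in> V. p v = p x\<^sub>0} \<and> (\<forall>x\<in>H. \<forall>y\<in>H. q x = q y)}"
  obtain F where F: "F \<in> \<Delta>" "p ` F = p ` V - {p x\<^sub>0}" and link: "link \<Delta> F = ?\<Gamma>"
    by (rule link_single_component)
  have cx: "simplicial_complex (link \<Delta> F)"
    by (rule simplicial_complex_link[OF simplicial F(1)])
  obtain x where x: "x \<in> V" "x \<noteq> x\<^sub>0" "q x = q x\<^sub>0"
    using thick[OF x\<^sub>0] by blast
  have "{x\<^sub>0, x} \<in> link \<Delta> F"
    unfolding link using x x\<^sub>0 refines[OF x(1) x\<^sub>0 x(3)] by auto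
  then have "face_dim {x\<^sub>0, x} \<le> complex_dim (link \<Delta> F)"
    unfolding complex_dim_def using simplicial_complex_finite[OF cx] by (intro Max_ge) auto
  then have "0 < complex_dim (link \<Delta> F)"
    using x(2) by (simp add: face_dim_def)
  moreover have "\<not> homology_vanishes TYPE('k) (link \<Delta> F) 0"
    \<comment> \<open>The part of \<open>x\<^sub>0\<close> is a component of the link that misses \<open>y\<^sub>0\<close>.\<close>
  proof (rule homology_0_disconnected[OF cx, of x\<^sub>0 "{v. q v = q x\<^sub>0}" y\<^sub>0])
    show "{x\<^sub>0} \<in> link \<Delta> F" "{y\<^sub>0} \<in> link \<Delta> F"
      unfolding link using x\<^sub>0 y\<^sub>0 same_p by auto
    show "x\<^sub>0 \<in> {v. q v = q x\<^sub>0}" "y\<^sub>0 \<notin> {v. q v = q x\<^sub>0}"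
      using diff_q by auto
    show "v \<in> {v. q v = q x\<^sub>0}" if "{u, v} \<in> link \<Delta> F" "u \<in> {v. q v = q x\<^sub>0}" for u v
    proof -
      have "q v = q u"
        using that(1) unfolding link by blast
      then show ?thesis
        using that(2) by simp
    qed
  qed
  ultimately show ?thesis
    by (rule that[OF F])
qed

theorem not_cohen_macaulay: "\<not> cohen_macaulay TYPE('k::field) \<Delta>"
proof -
  obtain F where "F \<in> \<Delta>" "p ` F = p ` V - {p x\<^sub>0}" "0 < complex_dim (link \<Delta> F)"
    "\<not> homology_vanishes TYPE('k) (link \<Delta> F) 0"
    by (rule disconnected_link)
  then show ?thesis
    unfolding cohen_macaulay_def by blast
qed

text \<open>With a second component, the face with the disconnected link is nonempty, so that this link
  already occurs inside the link of a vertex.\<close>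

theorem not_buchsbaum:
  assumes "v \<in> V" "p v \<noteq> p x\<^sub>0"
  shows "\<not> buchsbaum TYPE('k::field) \<Delta>"
proof
  assume buchsbaum: "buchsbaum TYPE('k) \<Delta>"
  obtain F where F: "F \<in> \<Delta>" "p ` F = p ` V - {p x\<^sub>0}" "0 < complex_dim (link \<Delta> F)"
    "\<not> homology_vanishes TYPE('k) (link \<Delta> F) 0"
    by (rule disconnected_link)
  then have "p v \<in> p ` F"
    using assms by blast
  then obtain x where x: "x \<in> F"
    by blast
  have "F - {x} \<in> \<Delta>" "{x} \<in> \<Delta>"
    using simplicial_complex_subset[OF simplicial F(1)] x by auto
  then have face: "F - {x} \<in> link \<Delta> {x}" and vert: "x \<in> vertices \<Delta>"
    using F(1) x by (auto simp: link_def vertices_def insert_absorb)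
  have "link (link \<Delta> {x}) (F - {x}) = link \<Delta> F"
    using link_link[OF simplicial, of "{x}" "F - {x}"] x by (simp add: insert_absorb)
  then have "\<not> cohen_macaulay TYPE('k) (link \<Delta> {x})"
    using F(3,4) face unfolding cohen_macaulay_def by metis
  then show False
    using buchsbaum vert unfolding buchsbaum_def by blast
qed

end

text \<open>In a single complete multipartite graph, the independent sets that contain \<open>x\<close> lie inside the
  part of \<open>x\<close>.\<close>

lemma buchsbaum_single_component:
  fixes p :: "'a::linorder \<Rightarrow> 'b"
  assumes fin: "finite V" and single: "\<And>x y. x \<in> V \<Longrightarrow> y \<in> V \<Longrightarrow> p x = p y"
    and pure: "pure (multipartite_complex p q V)"
  shows "buchsbaum TYPE('k::field) (multipartite_complex p q V)"
proof -
  let ?\<Delta> = "multipartite_complex p q V"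
  have faces: "F \<in> ?\<Delta> \<longleftrightarrow> F \<subseteq> V \<and> (\<forall>x\<in>F. \<forall>y\<in>F. q x = q y)" for F
    unfolding multipartite_complex_def using single by blast
  have "link ?\<Delta> {x} = transversal_complex id {v \<in> V. v \<noteq> x \<and> q v = q x}"
    if "x \<in> vertices ?\<Delta>" for x
  proof (rule set_eqI)
    fix H
    have "H \<in> link ?\<Delta> {x} \<longleftrightarrow> x \<notin> H \<and> insert x H \<in> ?\<Delta>"
      unfolding link_def faces by blast
    also have "\<dots> \<longleftrightarrow> H \<subseteq> {v \<in> V. v \<noteq> x \<and> q v = q x}"
    proof
      show "H \<subseteq> {v \<in> V. v \<noteq> x \<and> q v = q x}" if "x \<notin> H \<and> insert x H \<in> ?\<Delta>"
        using that unfolding faces by blast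
      assume H: "H \<subseteq> {v \<in> V. v \<noteq> x \<and> q v = q x}"
      then have qx: "q v = q x" if "v \<in> insert x H" for v
        using that by blast
      have "q u = q v" if "u \<in> insert x H" "v \<in> insert x H" for u v
        using qx[OF that(1)] qx[OF that(2)] by simp
      moreover have "x \<in> V"
        using \<open>x \<in> vertices ?\<Delta>\<close> unfolding vertices_def faces by blast
      moreover have "x \<notin> H" "H \<subseteq> V"
        using H by auto
      ultimately show "x \<notin> H \<and> insert x H \<in> ?\<Delta>"
        unfolding faces by blast
    qed
    finally show "H \<in> link ?\<Delta> {x} \<longleftrightarrow> H \<in> transversal_complex id {v \<in> V. v \<noteq> x \<and> q v = q x}"
      by (simp add: transversal_complex_def)
  qed
  then have "cohen_macaulay TYPE('k) (link ?\<Delta> {x})" if "x \<in> vertices ?\<Delta>" for x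
    using that cohen_macaulay_transversal[where V = "{v \<in> V. v \<noteq> x \<and> q v = q x}" and p = id] fin
    by simp
  then show ?thesis
    using pure by (simp add: buchsbaum_def)
qed


section \<open>One-paired circulants\<close>

lemma card_residue_class_below:
  fixes k m x :: nat
  assumes "0 < k"
  shows "card {y \<in> {..<k * m}. y mod k = x mod k} = m"
proof -
  have "{y \<in> {..<k * m}. y mod k = x mod k} = (\<lambda>j. x mod k + k * j) ` {..<m}"
  proof (intro set_eqI iffI)
    fix y assume y: "y \<in> {y \<in> {..<k * m}. y mod k = x mod k}"
    then have "y = x mod k + k * (y div k)"
      by (metis (mono_tags, lifting) mem_Collect_eq mod_mult_div_eq)
    moreover have "y div k < m"
      using y assms by (simp add: less_mult_imp_div_less mult.commute)
    ultimately show "y \<in> (\<lambda>j. x mod k + k * j) ` {..<m}"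
      by blast
  next
    fix y assume "y \<in> (\<lambda>j. x mod k + k * j) ` {..<m}"
    then obtain j where j: "j < m" "y = x mod k + k * j"
      by blast
    have "y < k * Suc j"
      using j(2) assms by simp
    also have "\<dots> \<le> k * m"
      using j(1) by (intro mult_le_mono2) simp
    finally show "y \<in> {y \<in> {..<k * m}. y mod k = x mod k}"
      using j(2) by simp
  qed
  moreover have "inj_on (\<lambda>j. x mod k + k * j) {..<m}"
    using assms by (auto simp: inj_on_def)
  ultimately show ?thesis
    by (simp add: card_image)
qed

text \<open>Since \<open>a * b\<close> divides \<open>n\<close>, both conditions on the distance \<open>d\<close> hold for \<open>d\<close> if and only if they
  hold for \<open>n - d\<close>, and the smaller of the two is at most \<open>n div 2\<close>.\<close>

lemma one_paired_circulant_edge: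
  fixes a b n :: nat
  assumes ab: "a * b dvd n" and xy: "x < n" "y < n"
  shows "{x, y} \<in> snd (one_paired_circulant n a b) \<longleftrightarrow>
    x mod a = y mod a \<and> x mod (a * b) \<noteq> y mod (a * b)"
proof -
  let ?d = "\<lambda>x y. nat \<bar>int x - int y\<bar>"
  let ?S = "{d \<in> {1..n div 2}. a dvd d \<and> \<not> a * b dvd d}"
  have dvd_d: "c dvd ?d x y \<longleftrightarrow> x mod c = y mod c" for c :: nat
  proof -
    have "c dvd ?d x y \<longleftrightarrow> int c dvd int x - int y"
      by (simp add: nat_dvd_iff flip: int_dvd_int_iff)
    also have "\<dots> \<longleftrightarrow> int x mod int c = int y mod int c"
      by (simp add: mod_eq_dvd_iff)
    also have "\<dots> \<longleftrightarrow> x mod c = y mod c"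
      by (metis of_nat_eq_iff zmod_int)
    finally show ?thesis .
  qed
  have dlt: "?d x y < n"
    using xy by auto
  have an: "a dvd n"
    using ab dvd_mult_left by blast
  have S: "d \<in> ?S \<or> n - d \<in> ?S \<longleftrightarrow> a dvd d \<and> \<not> a * b dvd d" if "d < n" for d
  proof (cases "d = 0")
    case True
    then show ?thesis
      using ab by auto
  next
    case False
    have "c dvd n - d \<longleftrightarrow> c dvd d" if "c dvd n" for c
      using dvd_diff_nat[OF that, of d] dvd_diff_nat[OF that, of "n - d"] \<open>d < n\<close> by auto
    then have "a dvd n - d \<longleftrightarrow> a dvd d" "a * b dvd n - d \<longleftrightarrow> a * b dvd d"
      using an ab by blast+
    moreover have "d \<le> n div 2 \<or> n - d \<le> n div 2"
      by linarith
    moreover have "1 \<le> d" "1 \<le> n - d"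
      using False that by simp_all
    ultimately show ?thesis
      unfolding mem_Collect_eq atLeastAtMost_iff by blast
  qed
  have "{x, y} \<in> snd (one_paired_circulant n a b) \<longleftrightarrow>
      x \<noteq> y \<and> (?d x y \<in> ?S \<or> n - ?d x y \<in> ?S)"
  proof -
    have sym: "?d u v = ?d v u" for u v
      by (simp add: abs_minus_commute)
    have pair: "{x, y} \<in> {{u, v} | u v. P u v} \<longleftrightarrow> P x y" if "\<And>u v. P u v \<Longrightarrow> P v u" for P
      using that by (auto simp: doubleton_eq_iff)
    have "{x, y} \<in> snd (one_paired_circulant n a b) \<longleftrightarrow>
        x < n \<and> y < n \<and> x \<noteq> y \<and> (?d x y \<in> ?S \<or> n - ?d x y \<in> ?S)"
      unfolding one_paired_circulant_def circulant_def snd_conv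
    proof (rule pair)
      show "v < n \<and> u < n \<and> v \<noteq> u \<and> (?d v u \<in> ?S \<or> n - ?d v u \<in> ?S)"
        if "u < n \<and> v < n \<and> u \<noteq> v \<and> (?d u v \<in> ?S \<or> n - ?d u v \<in> ?S)" for u v
        using that unfolding sym[of v u] by blast
    qed
    then show ?thesis
      using xy by blast
  qed
  then show ?thesis
    unfolding S[OF dlt] dvd_d by auto
qed

lemma independence_complex_one_paired_circulant:
  assumes "a * b dvd n"
  shows "independence_complex (one_paired_circulant n a b) =
    multipartite_complex (\<lambda>x. x mod a) (\<lambda>x. x mod (a * b)) {..<n}"
proof -
  have "fst (one_paired_circulant n a b) = {..<n}"
    by (simp add: one_paired_circulant_def circulant_def)
  moreover have "indep F (snd (one_paired_circulant n a b)) \<longleftrightarrow>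
      (\<forall>x\<in>F. \<forall>y\<in>F. x mod a = y mod a \<longrightarrow> x mod (a * b) = y mod (a * b))"
    if "F \<subseteq> {..<n}" for F
    unfolding indep_def using that one_paired_circulant_edge[OF assms]
    by (smt (verit) lessThan_iff subset_iff)
  ultimately show ?thesis
    unfolding independence_complex_def multipartite_complex_def by auto
qed

theorem corollary5p10:
  fixes a b n :: nat and \<Delta> :: "nat set set"
  assumes "0 < a" and "0 < b" and "0 < n" and "a * b dvd n"
    and "b \<ge> 2 \<or> n = a * b"
    and "\<Delta> = independence_complex (one_paired_circulant n a b)"
  shows "((vertex_decomposable \<Delta> \<longleftrightarrow> n = a * b) \<and>
      (shellable \<Delta> \<longleftrightarrow> n = a * b) \<and>
      (cohen_macaulay TYPE('k::field) \<Delta> \<longleftrightarrow> n = a * b)) \<and>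
    (buchsbaum TYPE('k) \<Delta> \<and> \<not> cohen_macaulay TYPE('k) \<Delta> \<longleftrightarrow> a = 1 \<and> a * b < n) \<and>
    (pure \<Delta> \<and> \<not> buchsbaum TYPE('k) \<Delta> \<longleftrightarrow> 1 < a \<and> a * b < n)"
proof -
  let ?p = "\<lambda>x::nat. x mod a"
  let ?q = "\<lambda>x::nat. x mod (a * b)"
  have \<Delta>: "\<Delta> = multipartite_complex ?p ?q {..<n}"
    using assms(4,6) independence_complex_one_paired_circulant by simp
  interpret multipartite ?p ?q "{..<n}"
  proof
    show "?p x = ?p y" if "?q x = ?q y" for x y
      using that by (metis dvd_triv_left mod_mod_cancel)
  qed simp
  have cx: "simplicial_complex \<Delta>"
    unfolding \<Delta> by (rule simplicial)
  obtain m where m: "n = a * b * m"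
    using assms(4) by blast
  have part: "card {y \<in> {..<n}. ?q y = ?q x} = m" for x
    unfolding m using assms(1,2) by (intro card_residue_class_below) simp
  have pure: "pure \<Delta>"
    unfolding \<Delta> by (rule pure_if_equal_parts) (rule part)
  show ?thesis
  proof (cases "n = a * b")
    case True
    have "inj_on ?q {..<n}"
      using True by (auto simp: inj_on_def)
    then have T: "\<Delta> = transversal_complex ?p {..<n}"
      unfolding \<Delta> by (rule multipartite_eq_transversal)
    have vd: "vertex_decomposable \<Delta>"
      unfolding T by (rule vertex_decomposable_transversal) simp
    have sh: "shellable \<Delta>"
      by (rule vertex_decomposable_imp_shellable[OF vd cx])
    have cm: "cohen_macaulay TYPE('k) \<Delta>"
      unfolding T by (rule cohen_macaulay_transversal) simp
    then have "buchsbaum TYPE('k) \<Delta>"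
      by (rule cohen_macaulay_imp_buchsbaum[OF cx])
    then show ?thesis
      using True vd sh cm by simp
  next
    case False
    have b: "2 \<le> b"
      using assms(5) False by simp
    have m2: "2 \<le> m"
      using m assms(3) False by (cases m; cases "m - 1") auto
    have lt: "a * b < n"
      using dvd_imp_le[OF assms(4,3)] False by simp
    have "a * 1 < a * b"
      using assms(1) b by (intro mult_strict_left_mono) auto
    then have a: "a < a * b"
      by simp
    \<comment> \<open>The vertices \<open>0\<close> and \<open>a\<close> lie in different parts because \<open>b\<close> is at least 2.\<close>
    interpret ordered_thick_multipartite ?p ?q "{..<n}" 0 a
    proof
      fix x assume "x \<in> {..<n}"
      have "\<not> {y \<in> {..<n}. ?q y = ?q x} \<subseteq> {x}"
        using part[of x] m2 card_mono[of "{x}" "{y \<in> {..<n}. ?q y = ?q x}"] by auto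
      then show "\<exists>x'\<in>{..<n}. x' \<noteq> x \<and> ?q x' = ?q x"
        by blast
    next
      show "?q 0 \<noteq> ?q a"
        using a assms(1) by simp
    qed (use less_trans[OF a lt] assms(3) in auto)
    have sh: "\<not> shellable \<Delta>" and cm: "\<not> cohen_macaulay TYPE('k) \<Delta>"
      unfolding \<Delta> by (rule not_shellable, rule not_cohen_macaulay)
    then have vd: "\<not> vertex_decomposable \<Delta>"
      using vertex_decomposable_imp_shellable cx by blast
    have "buchsbaum TYPE('k) \<Delta> \<longleftrightarrow> a = 1"
    proof
      assume "a = 1"
      then show "buchsbaum TYPE('k) \<Delta>"
        using buchsbaum_single_component[of "{..<n}" ?p] pure unfolding \<Delta> by simp
    next
      assume buchsbaum: "buchsbaum TYPE('k) \<Delta>"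
      show "a = 1"
      proof (rule ccontr)
        assume "a \<noteq> 1"
        then have "1 < a"
          using assms(1) by simp
        then show False
          \<comment> \<open>The vertex \<open>1\<close> lies outside the component of \<open>0\<close>.\<close>
          using not_buchsbaum[of 1, where 'k = 'k] buchsbaum a lt unfolding \<Delta> by simp
      qed
    qed
    then show ?thesis
      using False sh cm vd pure lt assms(1) by auto
  qed
qed

end
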